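(* Let $A\in\mathbb{R}^{n\times n}$ be the adjacency matrix of a finite directed weighted graph $G=(V,E,\Omega)$ without loops, with positive edge weights, so $A_{ij}=\Omega((i,j))>0$ if $(i,j)\in E$ and $A_{ij}=0$ otherwise, and $A_{ii}=0$. For $k\ge 0$ let $p_k(A)\in\mathbb{R}^{n\times n}$ be the matrix whose $(i,j)$ entry is the sum of the weights of all nonbacktracking walks of length $k$ from node $i$ to node $j$, with $p_0(A)=I$. Then for all $k\ge 1$, \[ p_k(A) = \sum_{\substack{\ell=2h+1 \text{ odd} \\ 1 \leq \ell \leq k}} \bigl(A^{\circ (h+1)} \circ (A^T)^{\circ h} \bigr)\, p_{k-\ell}(A) \;-\; \sum_{\substack{\ell=2h \text{ even} \\ 2 \leq \ell \leq k}} \operatorname{dd}\!\bigl((A^{\circ h})^2\bigr)\, p_{k-\ell}(A). \]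
   Context: A walk of length $\ell$ is a sequence of nodes $i_1,\dots,i_{\ell+1}$ with $(i_j,i_{j+1})\in E$ for all $j$; its weight is $\prod_{j=1}^{\ell} A_{i_j i_{j+1}}$. A walk is nonbacktracking if its node sequence contains no consecutive subsequence of the form $i\,j\,i$. $X\circ Y$ is the elementwise (Hadamard) product, $X^{\circ k}$ the elementwise $k$-th power ($(X^{\circ k})_{ij}=(X_{ij})^k$), with the convention that $X^{\circ 0}=\mathbf{1}\mathbf{1}^T$ is the all-ones matrix. $\operatorname{dd}(X)$ denotes the diagonal matrix with the same diagonal entries as $X$. Products written without $\circ$ are ordinary matrix products. *)

theory Defs
  imports "HOL-Analysis.Analysis" "HOL-Library.Sublist"
begin

text \<open>
  A finite directed weighted graph has node set \<open>UNIV :: 'n set\<close> (so \<open>n = CARD('n)\<close>),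
  edge set \<open>E\<close> and weight function \<open>\<Omega>\<close>; values of \<open>\<Omega>\<close> outside \<open>E\<close> are irrelevant.
\<close>

definition adjacency_matrix :: "('n \<times> 'n) set \<Rightarrow> ('n \<times> 'n \<Rightarrow> real) \<Rightarrow> real ^ 'n ^ 'n" where
  "adjacency_matrix E \<Omega> = (\<chi> i j. if (i, j) \<in> E then \<Omega> (i, j) else 0)"

definition walk :: "('n \<times> 'n) set \<Rightarrow> nat \<Rightarrow> 'n list \<Rightarrow> bool" where
  "walk E l xs \<longleftrightarrow> length xs = l + 1 \<and> (\<forall>j<l. (xs ! j, xs ! (j + 1)) \<in> E)"

text \<open>The length of the walk \<open>xs\<close> is \<open>length xs - 1\<close>; a single node has weight 1.\<close>

definition walk_weight :: "real ^ 'n ^ 'n \<Rightarrow> 'n list \<Rightarrow> real" where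
  "walk_weight A xs = (\<Prod>j<length xs - 1. A $ (xs ! j) $ (xs ! (j + 1)))"

text \<open>\<open>sublist\<close> is the contiguous-sublist relation.\<close>

definition nonbacktracking :: "'n list \<Rightarrow> bool" where
  "nonbacktracking xs \<longleftrightarrow> \<not> (\<exists>i j. sublist [i, j, i] xs)"

definition nb_walks :: "('n \<times> 'n) set \<Rightarrow> nat \<Rightarrow> 'n \<Rightarrow> 'n \<Rightarrow> 'n list set" where
  "nb_walks E k i j = {xs. walk E k xs \<and> nonbacktracking xs \<and> hd xs = i \<and> last xs = j}"

definition nb_walk_matrix :: "('n \<times> 'n) set \<Rightarrow> real ^ 'n ^ 'n \<Rightarrow> nat \<Rightarrow> real ^ 'n ^ 'n" where
  "nb_walk_matrix E A k = (\<chi> i j. \<Sum>xs\<in>nb_walks E k i j. walk_weight A xs)"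

text \<open>
  On type \<open>vec\<close> the library's \<open>*\<close> and \<open>^\<close> are the componentwise operations, hence the
  Hadamard product and power on matrices; \<open>X ^ 0\<close> is the all-ones matrix. The ordinary
  matrix product is \<open>**\<close>.
\<close>

abbreviation hadamard :: "real ^ 'n ^ 'n \<Rightarrow> real ^ 'n ^ 'n \<Rightarrow> real ^ 'n ^ 'n"
    (infixl "\<circ>\<^sub>H" 70) where
  "X \<circ>\<^sub>H Y \<equiv> X * Y"

abbreviation hadamard_power :: "real ^ 'n ^ 'n \<Rightarrow> nat \<Rightarrow> real ^ 'n ^ 'n"
    (infixr "^\<^sub>H" 80) where
  "X ^\<^sub>H k \<equiv> X ^ k"

definition dd :: "real ^ 'n ^ 'n \<Rightarrow> real ^ 'n ^ 'n" where
  "dd X = (\<chi> i j. if i = j then X $ i $ j else 0)"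

lemma hadamard_nth: "(X \<circ>\<^sub>H Y) $ i $ j = X $ i $ j * Y $ i $ j"
  by simp

lemma hadamard_power_nth: "(X ^\<^sub>H k) $ i $ j = (X $ i $ j) ^ k"
  by (induction k) simp_all

lemma finite_nb_walks: "finite (nb_walks E k i (j :: 'n :: finite))"
proof (rule finite_subset)
  show "nb_walks E k i j \<subseteq> {xs. set xs \<subseteq> UNIV \<and> length xs = k + 1}"
    by (auto simp: nb_walks_def walk_def)
  show "finite {xs :: 'n list. set xs \<subseteq> UNIV \<and> length xs = k + 1}"
    by (rule finite_lists_length_eq) simp
qed

lemma nb_walk_matrix_0: "nb_walk_matrix E A 0 = mat 1"
proof -
  have "nb_walks E 0 i j = (if i = j then {[i]} else {})" for i j
    by (auto simp: nb_walks_def walk_def nonbacktracking_def length_Suc_conv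
        dest: sublist_length_le)
  then show ?thesis
    by (simp add: nb_walk_matrix_def mat_def vec_eq_iff walk_weight_def)
qed

end

theory Submission
  imports Defs
begin

text \<open>
  Let \<open>q\<^sub>k(i, m, j)\<close> be the total weight of the nonbacktracking walks of length \<open>k\<close> from \<open>i\<close> to
  \<open>j\<close> whose second node is \<open>m\<close>. Removing the first node leaves a nonbacktracking walk from \<open>m\<close>
  whose second node is not \<open>i\<close>, so
  \<open>q\<^sub>k\<^sub>+\<^sub>1(i, m, j) = A\<^sub>i\<^sub>m (p\<^sub>k(m, j) - q\<^sub>k(m, i, j))\<close>.
  Unrolling this recursion, in which \<open>i\<close> and \<open>m\<close> swap roles at each step, expresses
  \<open>q\<^sub>k\<close> through \<open>p\<^sub>0, \<dots>, p\<^sub>k\<^sub>-\<^sub>1\<close> with alternating signs; summing over \<open>m\<close> gives the theorem.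
\<close>

lemma walk_Cons_Cons:
  "walk E (Suc k) (x # y # ys) \<longleftrightarrow> (x, y) \<in> E \<and> walk E k (y # ys)"
  by (auto simp: walk_def All_less_Suc2)

text \<open>Prepending \<open>x\<close> can create a forbidden pattern only at the front, as
  \<open>[x, y, x]\<close>.\<close>

lemma nonbacktracking_Cons_Cons:
  "nonbacktracking (x # y # ys) \<longleftrightarrow> nonbacktracking (y # ys) \<and> (ys = [] \<or> hd ys \<noteq> x)"
  by (cases ys) (auto simp: nonbacktracking_def sublist_Cons_right)

lemma walk_weight_Cons_Cons:
  "walk_weight A (x # y # ys) = A $ x $ y * walk_weight A (y # ys)"
  by (simp add: walk_weight_def prod.lessThan_Suc_shift del: prod.lessThan_Suc)

text \<open>Empty for \<open>k = 0\<close>, so that the recursion for the total weight holds from \<open>k = 0\<close> on.\<close>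

definition nb_walks_via :: "('n \<times> 'n) set \<Rightarrow> nat \<Rightarrow> 'n \<Rightarrow> 'n \<Rightarrow> 'n \<Rightarrow> 'n list set" where
  "nb_walks_via E k i m j = {xs \<in> nb_walks E k i j. k > 0 \<and> xs ! 1 = m}"

definition nb_via_weight ::
    "('n \<times> 'n) set \<Rightarrow> real ^ 'n ^ 'n \<Rightarrow> nat \<Rightarrow> 'n \<Rightarrow> 'n \<Rightarrow> 'n \<Rightarrow> real" where
  "nb_via_weight E A k i m j = (\<Sum>xs\<in>nb_walks_via E k i m j. walk_weight A xs)"

text \<open>Walks of positive length are partitioned by their second node.\<close>

lemma nb_walk_matrix_eq_sum_nb_via_weight:
  fixes E :: "('n :: finite \<times> 'n) set"
  assumes "k > 0"
  shows "nb_walk_matrix E A k $ i $ j = (\<Sum>m\<in>UNIV. nb_via_weight E A k i m j)"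
proof -
  have "nb_walks_via E k i m j = {xs \<in> nb_walks E k i j. xs ! 1 = m}" for m
    using assms by (auto simp: nb_walks_via_def)
  then show ?thesis
    using sum.group[OF finite_nb_walks[of E k i j] finite subset_UNIV,
      where g = "\<lambda>xs. xs ! 1" and h = "walk_weight A"]
    by (simp add: nb_walk_matrix_def nb_via_weight_def)
qed

lemma nb_walks_via_Suc:
  "nb_walks_via E (Suc k) i m j =
    (if (i, m) \<in> E then Cons i ` (nb_walks E k m j - nb_walks_via E k m i j) else {})"
proof (rule set_eqI)
  fix xs
  show "xs \<in> nb_walks_via E (Suc k) i m j \<longleftrightarrow>
    xs \<in> (if (i, m) \<in> E then Cons i ` (nb_walks E k m j - nb_walks_via E k m i j) else {})"
  proof (cases "\<exists>x y ys. xs = x # y # ys")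
    case True
    then obtain x y ys where xs: "xs = x # y # ys" by blast
    show ?thesis
    proof (cases "length ys = k")
      case True
      \<comment> \<open>This matches the guard \<open>k > 0\<close> in \<open>nb_walks_via\<close>
        with the exception \<open>ys = []\<close> in
        \<open>nonbacktracking_Cons_Cons\<close>.\<close>
      then have "0 < k \<longleftrightarrow> ys \<noteq> []" by auto
      then show ?thesis
        by (auto simp: xs nb_walks_via_def nb_walks_def walk_Cons_Cons nonbacktracking_Cons_Cons
            image_iff hd_conv_nth)
    next
      case False
      then show ?thesis
        by (auto simp: xs nb_walks_via_def nb_walks_def walk_def)
    qed
  next
    \<comment> \<open>Lists with fewer than two nodes lie in neither set: on the right,
      \<open>i\<close> is prepended to nonempty walks only.\<close>
    case False
    then have "length xs < 2"
      by (cases xs rule: remdups_adj.cases) auto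
    then show ?thesis
      by (auto simp: nb_walks_via_def nb_walks_def walk_def)
  qed
qed

lemma nb_via_weight_Suc:
  fixes E :: "('n :: finite \<times> 'n) set"
  assumes "A = adjacency_matrix E \<Omega>"
  shows "nb_via_weight E A (Suc k) i m j =
    A $ i $ m * (nb_walk_matrix E A k $ m $ j - nb_via_weight E A k m i j)"
proof (cases "(i, m) \<in> E")
  case True
  let ?S = "nb_walks E k m j - nb_walks_via E k m i j"
  have "nb_via_weight E A (Suc k) i m j = (\<Sum>xs\<in>?S. walk_weight A (i # xs))"
    using True by (simp add: nb_via_weight_def nb_walks_via_Suc sum.reindex)
  also have "\<dots> = (\<Sum>xs\<in>?S. A $ i $ m * walk_weight A xs)"
  proof (rule sum.cong)
    fix xs assume "xs \<in> ?S"
    then obtain ys where "xs = m # ys"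
      by (cases xs) (auto simp: nb_walks_def walk_def)
    then show "walk_weight A (i # xs) = A $ i $ m * walk_weight A xs"
      by (simp add: walk_weight_Cons_Cons)
  qed simp
  also have "\<dots> = A $ i $ m * (nb_walk_matrix E A k $ m $ j - nb_via_weight E A k m i j)"
    by (subst sum_distrib_left[symmetric], subst sum_diff)
      (auto simp: finite_nb_walks nb_walks_via_def nb_walk_matrix_def nb_via_weight_def)
  finally show ?thesis .
next
  case False
  \<comment> \<open>Without the edge there are no such walks, and the factor
    \<open>A $ i $ m\<close> is 0.\<close>
  then show ?thesis
    using assms by (simp add: nb_via_weight_def nb_walks_via_Suc adjacency_matrix_def)
qed

lemma finite_even_indices: "finite {h :: nat. 2 \<le> 2 * h \<and> 2 * h \<le> k}"
  by (rule finite_subset[of _ "{..k}"]) auto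

lemma nb_via_weight_expansion:
  fixes E :: "('n :: finite \<times> 'n) set"
  assumes "A = adjacency_matrix E \<Omega>"
  shows "nb_via_weight E A k i m j =
      (\<Sum>h | 2 * h + 1 \<le> k.
        (A $ i $ m) ^ (h + 1) * (A $ m $ i) ^ h * nb_walk_matrix E A (k - (2 * h + 1)) $ m $ j)
    - (\<Sum>h | 2 \<le> 2 * h \<and> 2 * h \<le> k.
        (A $ i $ m) ^ h * (A $ m $ i) ^ h * nb_walk_matrix E A (k - 2 * h) $ i $ j)"
proof (induction k arbitrary: i m)
  case 0
  have "{h :: nat. 2 \<le> 2 * h \<and> 2 * h \<le> 0} = {}" by auto
  then show ?case by (simp only:) (simp add: nb_via_weight_def nb_walks_via_def)
next
  case (Suc k)
  \<comment> \<open>The term h = 0 is the new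
    \<open>A $ i $ m * nb_walk_matrix E A k $ m $ j\<close>. The others are the even terms of the
    induction hypothesis for \<open>m\<close>, \<open>i\<close>: the factor
    \<open>- A $ i $ m\<close> flips their sign and raises one exponent.\<close>
  have "{h. 2 * h + 1 \<le> Suc k} = insert 0 {h. 2 \<le> 2 * h \<and> 2 * h \<le> k}"
    by auto
  then have odd: "(\<Sum>h | 2 * h + 1 \<le> Suc k. f h) = f 0 + (\<Sum>h | 2 \<le> 2 * h \<and> 2 * h \<le> k. f h)"
    for f :: "nat \<Rightarrow> real"
    by (simp only:) (subst sum.insert, use finite_even_indices in auto)
  \<comment> \<open>In the same way, the odd term h of the hypothesis becomes the even term
    \<open>Suc h\<close>, where both exponents are h + 1.\<close>
  have even: "{h. 2 \<le> 2 * h \<and> 2 * h \<le> Suc k} = Suc ` {h. 2 * h + 1 \<le> k}"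
  proof (rule set_eqI)
    fix h show "h \<in> {h. 2 \<le> 2 * h \<and> 2 * h \<le> Suc k} \<longleftrightarrow> h \<in> Suc ` {h. 2 * h + 1 \<le> k}"
      by (cases h) auto
  qed
  show ?case
    unfolding nb_via_weight_Suc[OF assms] Suc.IH odd even
    by (simp add: sum.reindex sum_distrib_left algebra_simps)
qed

theorem theorem3p1:
  fixes E :: "('n :: finite \<times> 'n) set"
    and \<Omega> :: "'n \<times> 'n \<Rightarrow> real"
    and A :: "real ^ 'n ^ 'n"
    and k :: nat
  assumes "irrefl E"
    and "\<And>e. e \<in> E \<Longrightarrow> \<Omega> e > 0"
    and "A = adjacency_matrix E \<Omega>"
    and "k \<ge> 1"
  shows "nb_walk_matrix E A k =
      (\<Sum>h | 1 \<le> 2 * h + 1 \<and> 2 * h + 1 \<le> k.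
        ((A ^\<^sub>H (h + 1)) \<circ>\<^sub>H ((transpose A) ^\<^sub>H h)) ** nb_walk_matrix E A (k - (2 * h + 1)))
    - (\<Sum>h | 2 \<le> 2 * h \<and> 2 * h \<le> k.
        dd ((A ^\<^sub>H h) ** (A ^\<^sub>H h)) ** nb_walk_matrix E A (k - 2 * h))"
proof -
  let ?p = "nb_walk_matrix E A"
  have odd: "(((A ^\<^sub>H (h + 1)) \<circ>\<^sub>H ((transpose A) ^\<^sub>H h)) ** B) $ i $ j =
      (\<Sum>m\<in>UNIV. (A $ i $ m) ^ (h + 1) * (A $ m $ i) ^ h * B $ m $ j)" for h B i j
    by (simp only: matrix_matrix_mult_def hadamard_nth hadamard_power_nth vec_lambda_beta
        transpose_def)
  \<comment> \<open>The diagonal entry at i of the squared Hadamard power is this sum over m without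
    B; a diagonal left factor only scales row i of B.\<close>
  have even: "(dd ((A ^\<^sub>H h) ** (A ^\<^sub>H h)) ** B) $ i $ j =
      (\<Sum>m\<in>UNIV. (A $ i $ m) ^ h * (A $ m $ i) ^ h * B $ i $ j)" for h B i j
    by (simp add: matrix_matrix_mult_def hadamard_power_nth dd_def if_distrib[of "\<lambda>x. x * _"]
        sum_distrib_right cong: if_cong)
  \<comment> \<open>Sum the expansion over the second node m, then exchange the sums over m and
    h.\<close>
  have "?p k $ i $ j =
      (\<Sum>h | 2 * h + 1 \<le> k. \<Sum>m\<in>UNIV.
        (A $ i $ m) ^ (h + 1) * (A $ m $ i) ^ h * ?p (k - (2 * h + 1)) $ m $ j)
    - (\<Sum>h | 2 \<le> 2 * h \<and> 2 * h \<le> k. \<Sum>m\<in>UNIV.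
        (A $ i $ m) ^ h * (A $ m $ i) ^ h * ?p (k - 2 * h) $ i $ j)" for i j
    using assms(4)
    by (simp only: nb_walk_matrix_eq_sum_nb_via_weight[of k] nb_via_weight_expansion[OF assms(3)]
        sum_subtractf sum.swap[of _ UNIV])
  then show ?thesis
    by (simp only: vec_eq_iff vector_minus_component sum_component odd even) simp
qed

end
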